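(* For every list (sequence) of functions $f_1,f_2,f_3,\ldots:\mathbb{N}\to\mathbb{N}$ there exists a function $g:\mathbb{N}\to\mathbb{N}$ that dominates every $f_i$ ($i\geq 1$).
   Context: A function $g:\mathbb{N}\to\mathbb{N}$ is said to dominate a function $f:\mathbb{N}\to\mathbb{N}$ when the inequality $g(x)>f(x)$ holds for all but finitely many $x\in\mathbb{N}$. *)

theory Defs
  imports Main
begin

definition dominates :: "(nat \<Rightarrow> nat) \<Rightarrow> (nat \<Rightarrow> nat) \<Rightarrow> bool"
  where "dominates g f \<longleftrightarrow> (\<forall>\<^sub>\<infinity>x. g x > f x)"

end

theory Submission
  imports Defs
begin

text \<open>Diagonalisation: at argument \<open>x\<close> only the finitely many functions
  \<open>f j\<close> with \<open>j \<le> x\<close> need to be exceeded, and one more than the sum of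
  their values does so. A fixed \<open>f i\<close> is thus beaten at every
  \<open>x \<ge> i\<close>.\<close>

theorem theorem5p1:
  fixes f :: "nat \<Rightarrow> nat \<Rightarrow> nat"
  shows "\<exists>g :: nat \<Rightarrow> nat. \<forall>i\<ge>1. dominates g (f i)"
proof (intro exI allI impI)
  fix i :: nat
  let ?g = "\<lambda>x. Suc (\<Sum>j\<le>x. f j x)"
  have "f i x < ?g x" if "i \<le> x" for x
    using that member_le_sum[of i "{..x}" "\<lambda>j. f j x"] by (simp add: less_Suc_eq_le)
  then show "dominates ?g (f i)"
    \<comment> \<open>On \<open>nat\<close>, "all but finitely many" means "from some point on"; the
      threshold here is \<open>i\<close> itself.\<close>
    unfolding dominates_def cofinite_eq_sequentially eventually_sequentially by blast
qed

end
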